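(* Let $O$ be a locally finite totally ordered set, let $S$ be an antichain of $(\mathscr I^\infty_O,\supseteq)$, and let $M=\bigwedge\{\widetilde I:I\in S\}$ (meet in $\mathscr E_O$). Then $M$ is the union of the following pairwise disjoint sets of intervals: (a) $\varepsilon(\ell'-1,r+1)$, for each pair of consecutive intervals of $S$ of the form $[-..r]$, $[\ell'..-]$; (b) $\widetilde{[\ell..\rightarrow)}$, if $S$ has a first interval and it is of the form $[\ell..-]$; (c) $\widetilde{(\leftarrow..r]}$, if $S$ has a last interval and it is of the form $[-..r]$; (d) $\widetilde{\emptyset}$, if $\emptyset\in S$; (e) $\{\emptyset\}$, if $S=\emptyset$.
   Context: $O=(O,\sqsubseteq)$ is locally finite and totally ordered. Intervals are convex subsets (including $\emptyset$); $\mathscr I_O$ = finite intervals, $\mathscr I^\infty_O$ = all intervals. $(\leftarrow..r]=\{x:x\sqsubseteq r\}$, $[\ell..\rightarrow)=\{x:\ell\sqsubseteq x\}$, $[\ell..r]=\{x:\ell\sqsubseteq x\sqsubseteq r\}$; $x\pm1$ denote successor/predecessor. "$[-..r]$" denotes a nonempty interval whose greatest element is $r$ (whether or not it has a least element), and "$[\ell..-]$" a nonempty interval whose least element is $\ell$. The nonempty intervals of an inclusion-antichain of intervals are totally ordered by their left ends (equivalently right ends); consecutive, first and last refer to this order. $\mathscr E_O$ is the set of inclusion-antichains of elements of $\mathscr I_O$, ordered by $A\le B$ iff for every $I\in A$ there is $J\in B$ with $J\subseteq I$. For an interval $I$, $\widetilde I=\{\{x\}:x\in O\setminus I\}$. For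 $\ell,r\in O$, $\varepsilon(\ell,r)=\{[\ell..r]\}$ if $\ell\sqsubset r$, and $\varepsilon(\ell,r)=\{\{x\}: r\sqsubseteq x\sqsubseteq\ell\}$ otherwise. *)

theory Defs
  imports "HOL-Algebra.Complete_Lattice" "HOL-Library.Disjoint_Sets" "HOL-Library.Extended"
begin

text \<open>
  The totally ordered set is a carrier \<open>X\<close> inside a linearly ordered type, with the
  induced order; in this way the empty order is covered as well.
\<close>

definition locally_finite_on :: "'a::linorder set \<Rightarrow> bool" where
  "locally_finite_on X \<longleftrightarrow> (\<forall>a\<in>X. \<forall>b\<in>X. finite (X \<inter> {a..b}))"

text \<open>Successor and predecessor in \<open>X\<close>; meaningful only where they exist.\<close>

definition succ_on :: "'a::linorder set \<Rightarrow> 'a \<Rightarrow> 'a" where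
  "succ_on X x = (LEAST y. y \<in> X \<and> x < y)"

definition pred_on :: "'a::linorder set \<Rightarrow> 'a \<Rightarrow> 'a" where
  "pred_on X x = (GREATEST y. y \<in> X \<and> y < x)"

definition intervals :: "'a::linorder set \<Rightarrow> 'a set set" where
  "intervals X = {I. I \<subseteq> X \<and> (\<forall>x\<in>I. \<forall>y\<in>I. \<forall>z\<in>X. x \<le> z \<and> z \<le> y \<longrightarrow> z \<in> I)}"

definition fin_intervals :: "'a::linorder set \<Rightarrow> 'a set set" where
  "fin_intervals X = {I \<in> intervals X. finite I}"

definition incl_antichain :: "'a set set \<Rightarrow> bool" where
  "incl_antichain A \<longleftrightarrow> (\<forall>I\<in>A. \<forall>J\<in>A. I \<subseteq> J \<longrightarrow> I = J)"

definition EE :: "'a::linorder set \<Rightarrow> 'a set set gorder" where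
  "EE X = \<lparr>carrier = {A. A \<subseteq> fin_intervals X \<and> incl_antichain A},
           eq = (=),
           le = (\<lambda>A B. \<forall>I\<in>A. \<exists>J\<in>B. J \<subseteq> I)\<rparr>"

definition tilde :: "'a set \<Rightarrow> 'a set \<Rightarrow> 'a set set" where
  "tilde X I = {{x} | x. x \<in> X - I}"

definition eps :: "'a::linorder set \<Rightarrow> 'a \<Rightarrow> 'a \<Rightarrow> 'a set set" where
  "eps X l r = (if l < r then {X \<inter> {l..r}} else {{x} | x. x \<in> X \<inter> {r..l}})"

definition least_in :: "'a::linorder \<Rightarrow> 'a set \<Rightarrow> bool" where
  "least_in l I \<longleftrightarrow> l \<in> I \<and> (\<forall>x\<in>I. l \<le> x)"

definition greatest_in :: "'a::linorder \<Rightarrow> 'a set \<Rightarrow> bool" where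
  "greatest_in r I \<longleftrightarrow> r \<in> I \<and> (\<forall>x\<in>I. x \<le> r)"

text \<open>
  A nonempty interval of a locally finite order without a least element is unbounded below
  (it contains everything below any of its elements), so its left end is \<open>-\<infinity>\<close>.
\<close>

definition left_end :: "'a::linorder set \<Rightarrow> 'a extended" where
  "left_end I = (if \<exists>l. least_in l I then Fin (LEAST x. x \<in> I) else -\<infinity>)"

definition first_interval :: "'a::linorder set set \<Rightarrow> 'a set \<Rightarrow> bool" where
  "first_interval S I \<longleftrightarrow> I \<in> S - {{}} \<and> (\<forall>K\<in>S - {{}}. left_end I \<le> left_end K)"

definition last_interval :: "'a::linorder set set \<Rightarrow> 'a set \<Rightarrow> bool" where
  "last_interval S I \<longleftrightarrow> I \<in> S - {{}} \<and> (\<forall>K\<in>S - {{}}. left_end K \<le> left_end I)"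

definition consecutive :: "'a::linorder set set \<Rightarrow> 'a set \<Rightarrow> 'a set \<Rightarrow> bool" where
  "consecutive S I J \<longleftrightarrow> I \<in> S - {{}} \<and> J \<in> S - {{}} \<and> left_end I < left_end J \<and>
     \<not> (\<exists>K\<in>S - {{}}. left_end I < left_end K \<and> left_end K < left_end J)"

text \<open>
  The pieces of the decomposition are indexed by labels rather than collected in a set of sets,
  so that disjointness also says that distinct labels do not give the same nonempty piece.
  In \<open>Gap I J r l\<close> the elements \<open>r\<close> and \<open>l\<close> are determined by \<open>I\<close> and \<open>J\<close>.
\<close>

datatype 'a label =
  Gap "'a set" "'a set" 'a 'a | Before 'a | After 'a | Empty_Member | Empty_Family

inductive_set labels :: "'a::linorder set set \<Rightarrow> 'a label set" for S where
  gap: "consecutive S I J \<Longrightarrow> greatest_in r I \<Longrightarrow> least_in l J \<Longrightarrow> Gap I J r l \<in> labels S"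
| before: "first_interval S I \<Longrightarrow> least_in l I \<Longrightarrow> Before l \<in> labels S"
| after: "last_interval S I \<Longrightarrow> greatest_in r I \<Longrightarrow> After r \<in> labels S"
| empty_member: "{} \<in> S \<Longrightarrow> Empty_Member \<in> labels S"
| empty_family: "S = {} \<Longrightarrow> Empty_Family \<in> labels S"

fun piece :: "'a::linorder set \<Rightarrow> 'a label \<Rightarrow> 'a set set" where
  "piece X (Gap I J r l) = eps X (pred_on X l) (succ_on X r)"
| "piece X (Before l) = tilde X (X \<inter> {l..})"
| "piece X (After r) = tilde X (X \<inter> {..r})"
| "piece X Empty_Member = tilde X {}"
| "piece X Empty_Family = {{}}"

text \<open>All meets in \<open>EE X\<close> exist, so \<open>\<Sqinter>\<^bsub>EE X\<^esub>\<close> is never an arbitrary choice.\<close>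

lemma minimal_subset_exists:
  assumes "finite I" "P I"
  shows "\<exists>J\<subseteq>I. P J \<and> (\<forall>K. P K \<and> K \<subseteq> J \<longrightarrow> K = J)"
  using assms
proof (induction I rule: finite_psubset_induct)
  case (psubset I)
  show ?case
  proof (cases "\<exists>K. P K \<and> K \<subset> I")
    case True
    then obtain K where "P K" "K \<subset> I" by blast
    with psubset.IH[of K] show ?thesis by blast
  next
    case False
    with psubset.prems show ?thesis by blast
  qed
qed

lemma partial_order_EE: "partial_order (EE X)"
proof (unfold_locales, goal_cases)
  case (5 A B)
  have sub: "A \<subseteq> B"
    if "A \<sqsubseteq>\<^bsub>EE X\<^esub> B" "B \<sqsubseteq>\<^bsub>EE X\<^esub> A" "A \<in> carrier (EE X)" for A B
  proof
    fix I assume I: "I \<in> A"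
    with that(1) obtain J where J: "J \<in> B" "J \<subseteq> I" by (auto simp: EE_def)
    with that(2) obtain K where K: "K \<in> A" "K \<subseteq> J" by (auto simp: EE_def)
    from that(3) I J K have "K = I" by (auto simp: EE_def incl_antichain_def)
    with J K show "I \<in> B" by auto
  qed
  from sub[of A B] sub[of B A] 5 show ?case by (auto simp: EE_def)
next
  case (6 A B C)
  show ?case unfolding EE_def gorder.simps
  proof
    fix I assume "I \<in> A"
    with 6(1) obtain J where "J \<in> B" "J \<subseteq> I" by (auto simp: EE_def)
    moreover from this(1) 6(2) obtain K where "K \<in> C" "K \<subseteq> J" by (auto simp: EE_def)
    ultimately show "\<exists>K\<in>C. K \<subseteq> I" by blast
  qed
qed (auto simp: EE_def)

lemma complete_lattice_EE: "complete_lattice (EE X)"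
proof -
  interpret partial_order "EE X" by (rule partial_order_EE)
  have inf: "\<exists>M. greatest (EE X) M (Lower (EE X) F)" if F: "F \<subseteq> carrier (EE X)" for F
  proof -
    define P where "P I \<longleftrightarrow> I \<in> fin_intervals X \<and> (\<forall>A\<in>F. \<exists>J\<in>A. J \<subseteq> I)" for I
    define M where "M = {J. P J \<and> (\<forall>K. P K \<and> K \<subseteq> J \<longrightarrow> K = J)}"
    have "greatest (EE X) M (Lower (EE X) F)"
    proof (rule greatest_LowerI)
      show "M \<in> carrier (EE X)"
        by (auto simp: EE_def M_def P_def incl_antichain_def)
      show "M \<sqsubseteq>\<^bsub>EE X\<^esub> A" if "A \<in> F" for A
        using that by (auto simp: EE_def M_def P_def)
      fix B assume B: "B \<in> Lower (EE X) F"
      have "\<exists>J\<in>M. J \<subseteq> I" if I: "I \<in> B" for I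
      proof -
        have "I \<in> fin_intervals X" using B I by (auto simp: Lower_def EE_def)
        moreover have "\<exists>J\<in>A. J \<subseteq> I" if "A \<in> F" for A
          using B I F that by (auto simp: Lower_def EE_def)
        ultimately have "P I" "finite I" by (auto simp: P_def fin_intervals_def)
        from minimal_subset_exists[of I P, OF this(2,1)] show ?thesis
          by (auto simp: M_def)
      qed
      then show "B \<sqsubseteq>\<^bsub>EE X\<^esub> M" by (simp add: EE_def)
    qed (rule F)
    then show ?thesis by blast
  qed
  have "\<exists>g. greatest (EE X) g (carrier (EE X))"
    using inf[of "{}"] by (simp add: Lower_empty)
  then show ?thesis by (rule complete_lattice_criterion1) (use inf in blast)
qed

lemma tilde_in_EE: "tilde X I \<in> carrier (EE X)"
  by (auto simp: EE_def tilde_def incl_antichain_def fin_intervals_def intervals_def)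

end

theory Submission
  imports Defs
begin

text \<open>
  The meet consists of the minimal finite intervals that are contained in no member of \<open>S\<close>.
  Such an interval is either a point outside \<open>\<Union>S\<close>, which lies before the first member, after the
  last one or between two consecutive ones, or an interval \<open>[a..b]\<close> with \<open>a < b\<close> such that
  \<open>[a..b-1]\<close> is covered by some \<open>K\<close> ending in \<open>b-1\<close> and \<open>[a+1..b]\<close> by some \<open>L\<close> beginning
  in \<open>a+1\<close>. A member of \<open>S\<close> strictly between \<open>K\<close> and \<open>L\<close> would contain \<open>[a..b]\<close>, so \<open>K\<close> and \<open>L\<close>
  are consecutive.
\<close>

section \<open>Meets in \<open>EE X\<close> and uncovered intervals\<close>

lemma Inf_EE:
  assumes "F \<subseteq> carrier (EE X)"
  defines "P \<equiv> \<lambda>I. I \<in> fin_intervals X \<and> (\<forall>A\<in>F. \<exists>J\<in>A. J \<subseteq> I)"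
  shows "\<Sqinter>\<^bsub>EE X\<^esub> F = {J. P J \<and> (\<forall>K. P K \<and> K \<subseteq> J \<longrightarrow> K = J)}" (is "_ = ?M")
proof -
  interpret partial_order "EE X" by (rule partial_order_EE)
  have "greatest (EE X) ?M (Lower (EE X) F)"
  proof (rule greatest_LowerI)
    show "?M \<in> carrier (EE X)"
      by (auto simp: EE_def P_def incl_antichain_def)
    show "?M \<sqsubseteq>\<^bsub>EE X\<^esub> A" if "A \<in> F" for A
      using that by (auto simp: EE_def P_def)
    fix B assume B: "B \<in> Lower (EE X) F"
    have "\<exists>J\<in>?M. J \<subseteq> I" if I: "I \<in> B" for I
    proof -
      have "I \<in> fin_intervals X" using B I by (auto simp: Lower_def EE_def)
      moreover have "\<exists>J\<in>A. J \<subseteq> I" if "A \<in> F" for A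
        using B I assms(1) that by (auto simp: Lower_def EE_def)
      ultimately have "P I" "finite I" by (auto simp: P_def fin_intervals_def)
      \<comment> \<open>Finiteness of \<open>I\<close> yields a minimal interval with
        \<open>P\<close> inside it.\<close>
      from minimal_subset_exists[of I P, OF this(2,1)] show ?thesis by auto
    qed
    then show "B \<sqsubseteq>\<^bsub>EE X\<^esub> ?M" by (simp add: EE_def)
  qed (rule assms(1))
  \<comment> \<open>The meet is a chosen greatest lower bound; uniqueness of greatest elements
    identifies the choice.\<close>
  then show ?thesis
    unfolding inf_def by (metis (no_types, lifting) greatest_unique someI)
qed

lemma fin_intervalsD:
  assumes "I \<in> fin_intervals X"
  shows "I \<subseteq> X" "finite I"
    "\<And>x y z. x \<in> I \<Longrightarrow> y \<in> I \<Longrightarrow> z \<in> X \<Longrightarrow> x \<le> z \<Longrightarrow> z \<le> y \<Longrightarrow> z \<in> I"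
  using assms unfolding fin_intervals_def intervals_def by blast+

text \<open>The empty interval is contained in every member, so it counts as uncovered only for
  \<open>S = {}\<close>, and then the family is \<open>{{}}\<close>.\<close>

definition minimal_uncovered :: "'a::linorder set \<Rightarrow> 'a set set \<Rightarrow> 'a set set" where
  "minimal_uncovered X S =
    {I \<in> fin_intervals X. (\<forall>K\<in>S. \<not> I \<subseteq> K) \<and>
      (\<forall>J\<in>fin_intervals X. (\<forall>K\<in>S. \<not> J \<subseteq> K) \<and> J \<subseteq> I \<longrightarrow> J = I)}"

lemma Inf_tilde:
  "\<Sqinter>\<^bsub>EE X\<^esub> (tilde X ` S) = minimal_uncovered X S"
proof -
  \<comment> \<open>A singleton from \<open>tilde X K\<close> inside \<open>I\<close> is a point of
    \<open>I\<close> outside \<open>K\<close>. This turns the lower bound condition of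
    \<open>Inf_EE\<close> into non-coverage.\<close>
  have "(\<exists>J\<in>tilde X K. J \<subseteq> I) \<longleftrightarrow> \<not> I \<subseteq> K" if "I \<in> fin_intervals X" for I K
    using fin_intervalsD(1)[OF that] unfolding tilde_def by blast
  then show ?thesis
    by (subst Inf_EE) (auto simp: tilde_in_EE minimal_uncovered_def)
qed

section \<open>Convexity and extremal elements in a locally finite order\<close>

locale interval_antichain =
  fixes X :: "'a::linorder set" and S :: "'a set set"
  assumes locally_finite: "locally_finite_on X"
    and intervals: "S \<subseteq> intervals X"
    and antichain: "incl_antichain S"
begin

lemma in_carrier: "K \<in> S \<Longrightarrow> x \<in> K \<Longrightarrow> x \<in> X"
  using intervals by (auto simp: intervals_def)

lemma convex:
  "K \<in> S \<Longrightarrow> x \<in> K \<Longrightarrow> y \<in> K \<Longrightarrow> z \<in> X \<Longrightarrow> x \<le> z \<Longrightarrow> z \<le> y \<Longrightarrow> z \<in> K"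
  using intervals by (fastforce simp: intervals_def)

lemma not_subset: "I \<in> S \<Longrightarrow> J \<in> S \<Longrightarrow> I \<noteq> J \<Longrightarrow> \<not> I \<subseteq> J"
  using antichain unfolding incl_antichain_def by blast

text \<open>From a chosen \<open>a\<close> upwards the set lies in \<open>X \<inter> {a..b}\<close>,
  hence is finite and has a maximum. Convexity is not assumed, so that the lemma also applies to
  sets of end points.\<close>

lemma greatest_exists:
  assumes "A \<subseteq> X" "A \<noteq> {}" "b \<in> X" "\<And>x. x \<in> A \<Longrightarrow> x \<le> b"
  shows "\<exists>r. greatest_in r A"
proof -
  obtain a where a: "a \<in> A" using assms by blast
  have fin: "finite (A \<inter> {a..})"
    by (rule finite_subset[of _ "X \<inter> {a..b}"])
      (use assms a locally_finite in \<open>auto simp: locally_finite_on_def\<close>)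
  have "Max (A \<inter> {a..}) \<in> A \<inter> {a..}" using fin a by (intro Max_in) auto
  moreover have "x \<le> Max (A \<inter> {a..})" if "x \<in> A" for x
  proof (cases "a \<le> x")
    case True then show ?thesis using fin that by (intro Max_ge) auto
  next
    case False then show ?thesis using calculation by auto
  qed
  ultimately show ?thesis by (auto simp: greatest_in_def)
qed

lemma least_exists:
  assumes "A \<subseteq> X" "A \<noteq> {}" "b \<in> X" "\<And>x. x \<in> A \<Longrightarrow> b \<le> x"
  shows "\<exists>l. least_in l A"
proof -
  obtain a where a: "a \<in> A" using assms by blast
  have fin: "finite (A \<inter> {..a})"
    by (rule finite_subset[of _ "X \<inter> {b..a}"])
      (use assms a locally_finite in \<open>auto simp: locally_finite_on_def\<close>)
  have "Min (A \<inter> {..a}) \<in> A \<inter> {..a}" using fin a by (intro Min_in) auto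
  moreover have "Min (A \<inter> {..a}) \<le> x" if "x \<in> A" for x
  proof (cases "x \<le> a")
    case True then show ?thesis using fin that by (intro Min_le) auto
  next
    case False then show ?thesis using calculation by auto
  qed
  ultimately show ?thesis by (auto simp: least_in_def)
qed

text \<open>The point \<open>y\<close> witnesses that something lies below \<open>x\<close>, so the
  \<open>GREATEST\<close> in the definition is attained.\<close>

lemma pred_on:
  assumes "x \<in> X" "y \<in> X" "y < x"
  shows "pred_on X x \<in> X" "pred_on X x < x" "\<And>z. z \<in> X \<Longrightarrow> z < x \<Longrightarrow> z \<le> pred_on X x"
proof -
  obtain p where p: "greatest_in p {y \<in> X. y < x}"
    using greatest_exists[of "{y \<in> X. y < x}" x] assms by fastforce
  have "pred_on X x = p"
    unfolding pred_on_def using p by (intro Greatest_equality) (auto simp: greatest_in_def)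
  with p show "pred_on X x \<in> X" "pred_on X x < x"
    "\<And>z. z \<in> X \<Longrightarrow> z < x \<Longrightarrow> z \<le> pred_on X x"
    by (auto simp: greatest_in_def)
qed

lemma succ_on:
  assumes "x \<in> X" "y \<in> X" "x < y"
  shows "succ_on X x \<in> X" "x < succ_on X x" "\<And>z. z \<in> X \<Longrightarrow> x < z \<Longrightarrow> succ_on X x \<le> z"
proof -
  obtain s where s: "least_in s {y \<in> X. x < y}"
    using least_exists[of "{y \<in> X. x < y}" x] assms by fastforce
  have "succ_on X x = s"
    unfolding succ_on_def using s by (intro Least_equality) (auto simp: least_in_def)
  with s show "succ_on X x \<in> X" "x < succ_on X x"
    "\<And>z. z \<in> X \<Longrightarrow> x < z \<Longrightarrow> succ_on X x \<le> z"
    by (auto simp: least_in_def)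
qed

section \<open>Comparison of members by their left ends\<close>

lemma left_end_least: "least_in l I \<Longrightarrow> left_end I = Fin l"
  by (auto simp: left_end_def least_in_def intro!: Least_equality)

text \<open>Replaces extended-valued left ends by points. \<open>J\<close> has a least element
  because something begins before it, and a member without a least element reaches below every point
  of \<open>X\<close>.\<close>

lemma left_end_less_iff:
  assumes "I \<in> S - {{}}" "J \<in> S - {{}}"
  shows "left_end I < left_end J \<longleftrightarrow> (\<exists>x\<in>I. \<forall>y\<in>J. x < y)"
proof
  assume less: "left_end I < left_end J"
  then obtain l where l: "least_in l J"
    by (fastforce simp: left_end_def split: if_splits)
  show "\<exists>x\<in>I. \<forall>y\<in>J. x < y"
  proof (cases "\<exists>k. least_in k I")
    case True
    then obtain k where "least_in k I" ..
    with less l show ?thesis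
      by (auto simp: left_end_least least_in_def intro!: bexI[of _ k])
  next
    case False
    have "\<exists>x\<in>I. x < l"
    proof (rule ccontr)
      assume "\<not> ?thesis"
      then have "\<exists>k. least_in k I"
        using assms l in_carrier by (intro least_exists[of I l]) (force simp: least_in_def)+
      with False show False ..
    qed
    with l show ?thesis by (force simp: least_in_def)
  qed
next
  assume "\<exists>x\<in>I. \<forall>y\<in>J. x < y"
  then obtain x where x: "x \<in> I" "\<And>y. y \<in> J \<Longrightarrow> x < y" by blast
  then obtain l where l: "least_in l J"
    using least_exists[of J x] assms in_carrier by (force intro: less_imp_le)
  show "left_end I < left_end J"
  proof (cases "\<exists>k. least_in k I")
    case True
    then obtain k where "least_in k I" ..
    with l x show ?thesis by (auto simp: left_end_least least_in_def intro: order.strict_trans1)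
  next
    case False
    then show ?thesis using l by (simp add: left_end_least[OF l]) (simp add: left_end_def)
  qed
qed

text \<open>Inclusion-incomparability makes the order by left ends agree with that by right ends.\<close>

lemma above_if_left_end_less:
  assumes "I \<in> S - {{}}" "J \<in> S - {{}}" "left_end I < left_end J"
  shows "\<exists>y\<in>J. \<forall>x\<in>I. x < y"
proof -
  obtain i where i: "i \<in> I" "\<And>y. y \<in> J \<Longrightarrow> i < y"
    using assms left_end_less_iff by blast
  then have "I \<noteq> J" by blast
  then have "\<not> J \<subseteq> I"
    using not_subset[of J I] assms by simp
  then obtain y where "y \<in> J" "y \<notin> I" by blast
  \<comment> \<open>Since \<open>y\<close> lies above \<open>i\<close> and outside \<open>I\<close>,
    convexity puts it above all of \<open>I\<close>.\<close>
  moreover have "x < y" if "x \<in> I" for x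
    using convex[of I i x y] in_carrier[of J y] calculation that assms i(2)[of y] i(1)
    by (meson DiffD1 less_imp_le not_le_imp_less)
  ultimately show ?thesis by blast
qed

text \<open>Two different members would each have a point outside the other. As neither begins
  first, the smaller of these points is enclosed by points of the interval that it avoids.\<close>

lemma left_end_inj:
  assumes "I \<in> S - {{}}" "J \<in> S - {{}}" "left_end I = left_end J"
  shows "I = J"
proof (rule ccontr)
  assume "I \<noteq> J"
  then have "\<not> I \<subseteq> J" "\<not> J \<subseteq> I" using not_subset[of I J] not_subset[of J I] assms by simp_all
  then obtain x y where xy: "x \<in> I" "x \<notin> J" "y \<in> J" "y \<notin> I" by blast
  obtain j where j: "j \<in> J" "j \<le> x"
    using left_end_less_iff[of I J] assms xy by (force simp: not_less)
  obtain i where i: "i \<in> I" "i \<le> y"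
    using left_end_less_iff[of J I] assms xy by (force simp: not_less)
  show False
    using convex[of J j y x] convex[of I i x y] in_carrier i j xy assms
    by (metis DiffD1 linear)
qed

section \<open>The shape of minimal uncovered intervals\<close>

lemma mem_minimal_uncovered_cases:
  assumes "A \<in> minimal_uncovered X S" "S \<noteq> {}"
  obtains (single) x where "A = {x}" "x \<in> X" "x \<notin> \<Union>S"
  | (long) a b K L where "A = X \<inter> {a..b}" "a \<in> X" "b \<in> X" "a < b"
      "K \<in> S" "b \<notin> K" "X \<inter> {a..<b} \<subseteq> K" "L \<in> S" "a \<notin> L" "X \<inter> {a<..b} \<subseteq> L"
      "\<forall>K\<in>S. \<not> X \<inter> {a..b} \<subseteq> K"
proof -
  have fin: "A \<in> fin_intervals X"
    using assms(1) unfolding minimal_uncovered_def by simp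
  note cv = fin_intervalsD(3)[OF fin]
  have A: "A \<subseteq> X" "finite A" "\<And>K. K \<in> S \<Longrightarrow> \<not> A \<subseteq> K"
    using fin_intervalsD(1,2)[OF fin] assms(1) unfolding minimal_uncovered_def by simp_all
  have min: "\<exists>K\<in>S. J \<subseteq> K" if "J \<in> fin_intervals X" "J \<subseteq> A" "J \<noteq> A" for J
  proof (rule ccontr)
    assume "\<not> ?thesis"
    then have "\<forall>K\<in>S. \<not> J \<subseteq> K" by simp
    then show False using assms(1) that unfolding minimal_uncovered_def by simp
  qed
  \<comment> \<open>Any member of the nonempty \<open>S\<close> would cover
    \<open>{}\<close>.\<close>
  have ne: "A \<noteq> {}" using A(3) assms(2) by auto
  define a b where "a = Min A" and "b = Max A"
  have ab: "a \<in> A" "b \<in> A" "\<And>x. x \<in> A \<Longrightarrow> a \<le> x \<and> x \<le> b"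
    using A ne by (auto simp: a_def b_def)
  have Aeq: "A = X \<inter> {a..b}"
  proof
    show "A \<subseteq> X \<inter> {a..b}" using A(1) ab(3) by auto
    show "X \<inter> {a..b} \<subseteq> A" using cv[OF ab(1,2)] by auto
  qed
  show thesis
  proof (cases "a = b")
    case True
    then have "A = {a}" using ab(1) ab(3) by (force intro: antisym)
    then show thesis using A single by auto
  next
    case False
    have X: "a \<in> X" "b \<in> X" "a < b"
      using ab(1,2) ab(3)[OF ab(2)] A(1) False by auto
    have sub: "X \<inter> {a..<b} \<subseteq> A" "X \<inter> {a<..b} \<subseteq> A" by (auto simp: Aeq)
    then have "finite (X \<inter> {a..<b})" "finite (X \<inter> {a<..b})"
      using A(2) finite_subset by blast+
    then have "X \<inter> {a..<b} \<in> fin_intervals X" "X \<inter> {a<..b} \<in> fin_intervals X"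
      by (force simp: fin_intervals_def intervals_def)+
    moreover have "X \<inter> {a..<b} \<noteq> A" "X \<inter> {a<..b} \<noteq> A" using ab(1,2) by auto
    \<comment> \<open>Deleting one end point gives a proper subinterval, which by minimality is
      covered.\<close>
    ultimately obtain K L where KL: "K \<in> S" "X \<inter> {a..<b} \<subseteq> K" "L \<in> S" "X \<inter> {a<..b} \<subseteq> L"
      using min[of "X \<inter> {a..<b}"] min[of "X \<inter> {a<..b}"] sub by meson
    have "A = insert b (X \<inter> {a..<b})" "A = insert a (X \<inter> {a<..b})"
      using X by (auto simp: Aeq)
    \<comment> \<open>With the deleted end point restored, \<open>K\<close> or \<open>L\<close>
      would cover all of \<open>A\<close>.\<close>
    then have "b \<notin> K" "a \<notin> L" using A(3)[OF KL(1)] A(3)[OF KL(3)] KL(2,4) by auto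
    then show thesis using long[of a b K L] Aeq X A(3) KL by simp
  qed
qed

text \<open>The only proper subset of \<open>{x}\<close> is \<open>{}\<close>, which is covered as
  soon as \<open>S\<close> has a member.\<close>

lemma singleton_minimal_uncovered:
  assumes "x \<in> X" "x \<notin> \<Union>S" "S \<noteq> {}"
  shows "{x} \<in> minimal_uncovered X S"
proof -
  have "J = {x}" if "\<forall>K\<in>S. \<not> J \<subseteq> K" "J \<subseteq> {x}" for J
    using that assms(3) by fastforce
  then show ?thesis
    using assms by (fastforce simp: minimal_uncovered_def fin_intervals_def intervals_def)
qed

text \<open>A subinterval without \<open>b\<close> lies in \<open>K\<close>, and one without
  \<open>a\<close> lies in \<open>L\<close>. An uncovered one thus contains both end points and, by
  convexity, everything between.\<close>

lemma interval_minimal_uncovered: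
  assumes "a \<in> X" "b \<in> X"
    and "K \<in> S" "X \<inter> {a..<b} \<subseteq> K" "L \<in> S" "X \<inter> {a<..b} \<subseteq> L"
    and uncovered: "\<And>K. K \<in> S \<Longrightarrow> \<not> X \<inter> {a..b} \<subseteq> K"
  shows "X \<inter> {a..b} \<in> minimal_uncovered X S"
proof -
  have "J = X \<inter> {a..b}"
    if J: "J \<in> fin_intervals X" "\<forall>K\<in>S. \<not> J \<subseteq> K" "J \<subseteq> X \<inter> {a..b}" for J
  proof -
    have "b \<in> J"
    proof (rule ccontr)
      assume "b \<notin> J"
      then have "J \<subseteq> X \<inter> {a..<b}" using J(3) by (force simp: order.strict_iff_order)
      with J(2) assms show False by blast
    qed
    have "a \<in> J"
    proof (rule ccontr)
      assume "a \<notin> J"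
      then have "J \<subseteq> X \<inter> {a<..b}" using J(3) by (force simp: order.strict_iff_order)
      with J(2) assms show False by blast
    qed
    then show ?thesis
      using fin_intervalsD(3)[OF J(1) \<open>a \<in> J\<close> \<open>b \<in> J\<close>] J(3) by auto
  qed
  moreover have "X \<inter> {a..b} \<in> fin_intervals X"
    using locally_finite assms(1,2)
    by (fastforce simp: fin_intervals_def intervals_def locally_finite_on_def)
  ultimately show ?thesis using uncovered unfolding minimal_uncovered_def by blast
qed

section \<open>Gaps between consecutive members\<close>

lemma consecutiveD:
  assumes "consecutive S I J"
  shows "I \<in> S - {{}}" "J \<in> S - {{}}" "left_end I < left_end J"
    "\<And>K. K \<in> S - {{}} \<Longrightarrow> left_end K < left_end J \<Longrightarrow> left_end K \<le> left_end I"
  using assms by (auto simp: consecutive_def not_less)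

text \<open>Supplies the witnesses that \<open>l\<close> has a predecessor and \<open>r\<close> a
  successor.\<close>

lemma gap_bounds:
  assumes "consecutive S I J" "greatest_in r I" "least_in l J"
  obtains x y where "x \<in> I" "x < l" "y \<in> J" "r < y"
  using above_if_left_end_less[of I J] left_end_less_iff[of I J] consecutiveD[OF assms(1)]
    assms(2,3) by (force simp: greatest_in_def least_in_def)

lemma gap_pred_succ:
  assumes "consecutive S I J" "greatest_in r I" "least_in l J"
  shows "pred_on X l \<in> X" "pred_on X l < l" "\<And>z. z \<in> X \<Longrightarrow> z < l \<Longrightarrow> z \<le> pred_on X l"
    "succ_on X r \<in> X" "r < succ_on X r" "\<And>z. z \<in> X \<Longrightarrow> r < z \<Longrightarrow> succ_on X r \<le> z"
proof -
  from assms obtain x y where "x \<in> I" "x < l" "y \<in> J" "r < y" by (rule gap_bounds)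
  moreover have "l \<in> J" "r \<in> I" using assms by (auto simp: greatest_in_def least_in_def)
  ultimately have *: "l \<in> X" "x \<in> X" "x < l" "r \<in> X" "y \<in> X" "r < y"
    using consecutiveD[OF assms(1)] in_carrier by blast+
  show "pred_on X l \<in> X" "pred_on X l < l" "\<And>z. z \<in> X \<Longrightarrow> z < l \<Longrightarrow> z \<le> pred_on X l"
    "succ_on X r \<in> X" "r < succ_on X r" "\<And>z. z \<in> X \<Longrightarrow> r < z \<Longrightarrow> succ_on X r \<le> z"
    using pred_on[OF *(1-3)] succ_on[OF *(4-6)] by blast+
qed

text \<open>In the first case of \<open>eps\<close> the interval has two distinct end points and is
  no singleton. In the second, the range from \<open>succ_on X r\<close> to
  \<open>pred_on X l\<close> consists of the points strictly between \<open>r\<close> and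
  \<open>l\<close>; such a point also excludes the first case.\<close>

lemma singleton_in_gap:
  assumes "consecutive S I J" "greatest_in r I" "least_in l J"
  shows "{x} \<in> piece X (Gap I J r l) \<longleftrightarrow> x \<in> X \<and> r < x \<and> x < l"
proof -
  note ps = gap_pred_succ[OF assms]
  have "X \<inter> {pred_on X l..succ_on X r} \<noteq> {x}" if "pred_on X l < succ_on X r"
  proof
    assume "X \<inter> {pred_on X l..succ_on X r} = {x}"
    moreover have "pred_on X l \<in> X \<inter> {pred_on X l..succ_on X r}"
      "succ_on X r \<in> X \<inter> {pred_on X l..succ_on X r}"
      using ps that by auto
    ultimately have "pred_on X l = x" "succ_on X r = x" by blast+
    then show False using that by auto
  qed
  moreover have "\<not> pred_on X l < succ_on X r" if "x \<in> X" "r < x" "x < l"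
    using ps(3,6)[of x] that by auto
  moreover have "succ_on X r \<le> x \<and> x \<le> pred_on X l \<longleftrightarrow> r < x \<and> x < l" if "x \<in> X"
    using ps(2,5) ps(3,6)[of x] that by auto
  ultimately show ?thesis by (auto simp: eps_def)
qed

lemma nonsingleton_in_gap:
  assumes "A \<in> piece X (Gap I J r l)" "\<nexists>x. A = {x}"
  shows "A = X \<inter> {pred_on X l..succ_on X r}" "pred_on X l < succ_on X r"
  using assms by (auto simp: eps_def split: if_splits)

text \<open>A member with a point below \<open>l\<close> begins before \<open>J\<close>, hence no
  later than \<open>I\<close>, and so it also ends no later than \<open>I\<close>. Both kinds of gap
  elements are shown to be uncovered in this way.\<close>

lemma not_across_gap:
  assumes "consecutive S I J" "greatest_in r I" "least_in l J"
    and "K \<in> S" "x \<in> K" "x < l" "y \<in> K"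
  shows "y \<le> r"
proof -
  have K: "K \<in> S - {{}}" using assms by auto
  note c = consecutiveD[OF assms(1)]
  have "left_end K < left_end J"
    unfolding left_end_less_iff[OF K c(2)]
    using assms by (auto simp: least_in_def intro!: bexI[of _ x])
  then have "left_end K \<le> left_end I" by (rule c(4)[OF K])
  then consider "left_end K < left_end I" | "K = I"
    using left_end_inj[OF K c(1)] by force
  then show ?thesis
  proof cases
    case 1
    from above_if_left_end_less[OF K c(1) 1] show ?thesis
      using assms by (force simp: greatest_in_def)
  next
    case 2
    then show ?thesis using assms by (auto simp: greatest_in_def)
  qed
qed

lemma long_gap_minimal_uncovered:
  assumes "consecutive S I J" "greatest_in r I" "least_in l J" "pred_on X l < succ_on X r"
  shows "X \<inter> {pred_on X l..succ_on X r} \<in> minimal_uncovered X S"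
proof -
  let ?p = "pred_on X l" and ?s = "succ_on X r"
  note ps = gap_pred_succ[OF assms(1-3)] and c = consecutiveD[OF assms(1)]
  obtain i j where ij: "i \<in> I" "i < l" "j \<in> J" "r < j"
    using gap_bounds[OF assms(1-3)] .
  have rl: "r \<in> I" "l \<in> J" "\<And>x. x \<in> I \<Longrightarrow> x \<le> r" "\<And>y. y \<in> J \<Longrightarrow> l \<le> y"
    using assms by (auto simp: greatest_in_def least_in_def)
  have X: "i \<in> X" "j \<in> X" using ij c in_carrier by auto
  \<comment> \<open>Here \<open>i \<le> ?p\<close> because \<open>i < l\<close>, and
    \<open>?p \<le> r\<close> because \<open>r < ?p\<close> would give \<open>?s \<le> ?p\<close>.
    The argument for \<open>?s\<close> is symmetric.\<close>
  have p: "?p \<in> I"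
    using convex[of I i r ?p] c ps ij X rl assms(4) by (meson DiffD1 leD not_le_imp_less)
  have s: "?s \<in> J"
    using convex[of J l j ?s] c ps ij X rl assms(4) by (meson DiffD1 leD not_le_imp_less)
  show ?thesis
  proof (rule interval_minimal_uncovered)
    show "X \<inter> {?p..<?s} \<subseteq> I"
    proof
      fix x assume x: "x \<in> X \<inter> {?p..<?s}"
      then have "x \<le> r" using ps(6)[of x] by force
      then show "x \<in> I" using convex[of I ?p r x] c(1) p rl(1) x by auto
    qed
    show "X \<inter> {?p<..?s} \<subseteq> J"
    proof
      fix x assume x: "x \<in> X \<inter> {?p<..?s}"
      then have "l \<le> x" using ps(3)[of x] by force
      then show "x \<in> J" using convex[of J l ?s x] c(2) s rl(2) x by auto
    qed
    fix K assume K: "K \<in> S"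
    show "\<not> X \<inter> {?p..?s} \<subseteq> K"
    proof
      assume "X \<inter> {?p..?s} \<subseteq> K"
      then have pK: "?p \<in> K" and sK: "?s \<in> K" using ps assms(4) by auto
      show False using not_across_gap[OF assms(1-3) K pK ps(2) sK] ps(5) by auto
    qed
  qed (use ps c in auto)
qed

section \<open>Bounds from the first and last members; pieces belong to the meet\<close>

lemma first_least_le:
  assumes "first_interval S I" "least_in l I" "K \<in> S" "x \<in> K"
  shows "l \<le> x"
proof (rule ccontr)
  assume "\<not> ?thesis"
  moreover have K: "K \<in> S - {{}}" using assms by auto
  moreover have I: "I \<in> S - {{}}" using assms by (auto simp: first_interval_def)
  ultimately have "left_end K < left_end I"
    unfolding left_end_less_iff[OF K I] using assms
    by (intro bexI[of _ x]) (auto simp: least_in_def not_le)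
  moreover have "left_end I \<le> left_end K"
    using assms(1) K unfolding first_interval_def by blast
  ultimately show False by simp
qed

text \<open>Being last refers to left ends; \<open>above_if_left_end_less\<close> carries it over to
  right ends.\<close>

lemma last_greatest_ge:
  assumes "last_interval S I" "greatest_in r I" "K \<in> S" "x \<in> K"
  shows "x \<le> r"
proof -
  have K: "K \<in> S - {{}}" using assms by auto
  have I: "I \<in> S - {{}}" "left_end K \<le> left_end I"
    using assms K by (auto simp: last_interval_def)
  show ?thesis
  proof (cases "K = I")
    case True then show ?thesis using assms by (auto simp: greatest_in_def)
  next
    case False
    then have "left_end K < left_end I" using I K left_end_inj[OF K I(1)] by force
    from above_if_left_end_less[OF K I(1) this] show ?thesis
      using assms by (force simp: greatest_in_def)
  qed
qed

lemma piece_subset: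
  assumes "i \<in> labels S"
  shows "piece X i \<subseteq> minimal_uncovered X S"
  using assms
proof cases
  case (gap I J r l)
  show ?thesis
  proof
    fix A assume A: "A \<in> piece X i"
    show "A \<in> minimal_uncovered X S"
    proof (cases "\<exists>x. A = {x}")
      case True
      then obtain x where "A = {x}" ..
      moreover have "x \<in> X" "r < x" "x < l"
        using A gap singleton_in_gap[of I J r l x] calculation by auto
      moreover have "x \<notin> \<Union>S" using not_across_gap[OF gap(2-4), of _ x x] calculation by fastforce
      moreover have "S \<noteq> {}" using consecutiveD(1)[OF gap(2)] by auto
      ultimately show ?thesis using singleton_minimal_uncovered by auto
    next
      case False
      with A nonsingleton_in_gap[of A I J r l] long_gap_minimal_uncovered[of I J r l] gap
      show ?thesis by auto
    qed
  qed
next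
  case (before I l)
  have "{x} \<in> minimal_uncovered X S" if x: "x \<in> X" "x < l" for x
  proof (rule singleton_minimal_uncovered[OF x(1)])
    show "x \<notin> \<Union>S"
      using first_least_le[OF before(2,3)] x(2) by (meson UnionE leD)
  qed (use before in \<open>auto simp: first_interval_def\<close>)
  then show ?thesis using before by (auto simp: tilde_def not_le)
next
  case (after I r)
  have "{x} \<in> minimal_uncovered X S" if x: "x \<in> X" "r < x" for x
  proof (rule singleton_minimal_uncovered[OF x(1)])
    show "x \<notin> \<Union>S"
      using last_greatest_ge[OF after(2,3)] x(2) by (meson UnionE leD)
  qed (use after in \<open>auto simp: last_interval_def\<close>)
  then show ?thesis using after by (auto simp: tilde_def not_le)
next
  case empty_member
  \<comment> \<open>An antichain containing \<open>{}\<close> has no other member, so every point of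
    \<open>X\<close> is uncovered.\<close>
  then have "S = {{}}" using antichain by (auto simp: incl_antichain_def)
  then show ?thesis
    using empty_member singleton_minimal_uncovered by (auto simp: tilde_def)
next
  case empty_family
  then show ?thesis
    by (auto simp: minimal_uncovered_def fin_intervals_def intervals_def)
qed

section \<open>Every minimal uncovered interval lies in a piece\<close>

lemma not_mem_cases:
  assumes "K \<in> S - {{}}" "x \<in> X" "x \<notin> K"
  obtains (below) "\<And>y. y \<in> K \<Longrightarrow> y < x" | (above) "\<And>y. y \<in> K \<Longrightarrow> x < y"
  using convex[of K _ _ x] assms by (metis DiffD1 not_le)

text \<open>Infinitely many members may lie below \<open>x\<close>. The last of them is found
  through the set of their right ends, which \<open>x\<close> bounds above, so that it has a
  greatest element.\<close>

lemma last_below_exists: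
  assumes x: "x \<in> X" and K: "K \<in> S - {{}}" "\<And>y. y \<in> K \<Longrightarrow> y < x"
  obtains I r where "I \<in> S - {{}}" "greatest_in r I" "r < x"
    "\<And>K. K \<in> S - {{}} \<Longrightarrow> (\<And>y. y \<in> K \<Longrightarrow> y < x) \<Longrightarrow> left_end K \<le> left_end I"
proof -
  let ?R = "{r. \<exists>K\<in>S - {{}}. greatest_in r K \<and> r < x}"
  have gr: "\<exists>r. greatest_in r K \<and> r < x" if "K \<in> S - {{}}" "\<And>y. y \<in> K \<Longrightarrow> y < x" for K
  proof -
    have "\<exists>r. greatest_in r K"
      using that x in_carrier by (intro greatest_exists[of K x]) (auto intro: less_imp_le)
    then show ?thesis using that(2) by (auto simp: greatest_in_def)
  qed
  have "\<exists>r. greatest_in r ?R"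
    using gr[OF K] x K(1) in_carrier
    by (intro greatest_exists[of ?R x]) (auto simp: greatest_in_def)
  then obtain r where r: "greatest_in r ?R" ..
  then obtain I where I: "I \<in> S - {{}}" "greatest_in r I" "r < x"
    by (auto simp: greatest_in_def)
  have "left_end K \<le> left_end I" if K: "K \<in> S - {{}}" "\<And>y. y \<in> K \<Longrightarrow> y < x" for K
  proof (rule ccontr)
    assume "\<not> ?thesis"
    then obtain y where "y \<in> K" "r < y"
      using above_if_left_end_less[OF I(1) K(1)] I(2) by (auto simp: greatest_in_def not_le)
    moreover obtain r' where "greatest_in r' K" "r' < x" using gr[OF K] by blast
    moreover have "r' \<le> r" using r K(1) calculation by (auto simp: greatest_in_def)
    ultimately show False by (auto simp: greatest_in_def)
  qed
  with I show thesis using that by blast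
qed

lemma first_above_exists:
  assumes x: "x \<in> X" and K: "K \<in> S - {{}}" "\<And>y. y \<in> K \<Longrightarrow> x < y"
  obtains J l where "J \<in> S - {{}}" "least_in l J" "x < l"
    "\<And>K. K \<in> S - {{}} \<Longrightarrow> (\<And>y. y \<in> K \<Longrightarrow> x < y) \<Longrightarrow> left_end J \<le> left_end K"
proof -
  let ?L = "{l. \<exists>K\<in>S - {{}}. least_in l K \<and> x < l}"
  have le: "\<exists>l. least_in l K \<and> x < l" if "K \<in> S - {{}}" "\<And>y. y \<in> K \<Longrightarrow> x < y" for K
  proof -
    have "\<exists>l. least_in l K"
      using that x in_carrier by (intro least_exists[of K x]) (auto intro: less_imp_le)
    then show ?thesis using that(2) by (auto simp: least_in_def)
  qed
  have "\<exists>l. least_in l ?L"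
    using le[OF K] x K(1) in_carrier
    by (intro least_exists[of ?L x]) (auto simp: least_in_def)
  then obtain l where l: "least_in l ?L" ..
  then obtain J where J: "J \<in> S - {{}}" "least_in l J" "x < l"
    by (auto simp: least_in_def)
  have "left_end J \<le> left_end K" if K: "K \<in> S - {{}}" "\<And>y. y \<in> K \<Longrightarrow> x < y" for K
  proof -
    obtain l' where l': "least_in l' K" "x < l'" using le[OF K] by blast
    then have "l \<le> l'" using l K(1) by (auto simp: least_in_def)
    then show ?thesis using J(2) l'(1) by (simp add: left_end_least)
  qed
  with J show thesis using that by blast
qed

lemma left_end_less_if_separated:
  assumes "I \<in> S - {{}}" "J \<in> S - {{}}" "\<And>y. y \<in> I \<Longrightarrow> y < x" "\<And>y. y \<in> J \<Longrightarrow> x < y"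
  shows "left_end I < left_end J"
  unfolding left_end_less_iff[OF assms(1,2)] using assms by (force intro: order.strict_trans)

text \<open>Each nonempty member lies entirely below or entirely above \<open>x\<close>. The last
  one below and the first one above are consecutive; if one side is vacant, \<open>x\<close> comes
  before the first or after the last member.\<close>

lemma uncovered_point_in_piece:
  assumes x: "x \<in> X" "x \<notin> \<Union>S" and S: "S \<noteq> {}"
  shows "\<exists>i\<in>labels S. {x} \<in> piece X i"
proof (cases "{} \<in> S")
  case True
  then show ?thesis
    using x by (auto simp: tilde_def intro!: bexI[OF _ labels.empty_member])
next
  case False
  then have S: "S - {{}} \<noteq> {}" using S by auto
  define B where "B K \<longleftrightarrow> (\<forall>y\<in>K. y < x)" for K
  define C where "C K \<longleftrightarrow> (\<forall>y\<in>K. x < y)" for K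
  have BC: "B K \<or> C K" if "K \<in> S - {{}}" for K
    using not_mem_cases[of K x] x that by (auto simp: B_def C_def)
  have less: "left_end I < left_end J" if "I \<in> S - {{}}" "J \<in> S - {{}}" "B I" "C J" for I J
    using left_end_less_if_separated[of I J x] that by (auto simp: B_def C_def)
  show ?thesis
  proof (cases "\<exists>K\<in>S - {{}}. B K")
    case someB: True
    then obtain I r where I: "I \<in> S - {{}}" "greatest_in r I" "r < x"
      "\<And>K. K \<in> S - {{}} \<Longrightarrow> B K \<Longrightarrow> left_end K \<le> left_end I"
      using last_below_exists[OF x(1)] unfolding B_def by metis
    have BI: "B I" using I by (auto simp: B_def greatest_in_def)
    show ?thesis
    proof (cases "\<exists>K\<in>S - {{}}. C K")
      case True
      then obtain J l where J: "J \<in> S - {{}}" "least_in l J" "x < l"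
        "\<And>K. K \<in> S - {{}} \<Longrightarrow> C K \<Longrightarrow> left_end J \<le> left_end K"
        using first_above_exists[OF x(1)] unfolding C_def by metis
      have CJ: "C J" using J by (auto simp: C_def least_in_def)
      have "consecutive S I J"
        unfolding consecutive_def using I(1,4) J(1,4) BC less[OF I(1) J(1) BI CJ] by (meson leD)
      then show ?thesis
        using I J x singleton_in_gap[of I J r l x] by (blast intro: labels.gap)
    next
      case False
      then have "last_interval S I" using I BC by (auto simp: last_interval_def)
      then have "After r \<in> labels S" using I by (blast intro: labels.after)
      then show ?thesis using I x by (force simp: tilde_def intro!: bexI[of _ "After r"])
    qed
  next
    case False
    then have allC: "C K" if "K \<in> S - {{}}" for K using BC that by blast
    then obtain J l where J: "J \<in> S - {{}}" "least_in l J" "x < l"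
      "\<And>K. K \<in> S - {{}} \<Longrightarrow> C K \<Longrightarrow> left_end J \<le> left_end K"
      using first_above_exists[OF x(1)] S unfolding C_def by (metis ex_in_conv)
    then have "first_interval S J" using allC by (auto simp: first_interval_def)
    then have "Before l \<in> labels S" using J by (blast intro: labels.before)
    then show ?thesis using J x by (force simp: tilde_def intro!: bexI[of _ "Before l"])
  qed
qed

lemma long_interval_in_gap:
  assumes long: "a \<in> X" "b \<in> X" "a < b"
    "K \<in> S" "b \<notin> K" "X \<inter> {a..<b} \<subseteq> K" "L \<in> S" "a \<notin> L" "X \<inter> {a<..b} \<subseteq> L"
    "\<forall>K\<in>S. \<not> X \<inter> {a..b} \<subseteq> K"
  shows "\<exists>i\<in>labels S. X \<inter> {a..b} \<in> piece X i"
proof -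
  have aK: "a \<in> K" and bL: "b \<in> L" using long by auto
  have K: "K \<in> S - {{}}" and L: "L \<in> S - {{}}" using long aK bL by auto
  have Kb: "y < b" if "y \<in> K" for y
    using convex[of K a y b] long aK that by (metis not_le order.strict_implies_order)
  have La: "a < y" if "y \<in> L" for y
    using convex[of L y b a] long bL that by (metis not_le order.strict_implies_order)
  have "\<exists>r. greatest_in r K" "\<exists>l. least_in l L"
    using K L Kb La long in_carrier
    by (intro greatest_exists[of K b] least_exists[of L a]; auto intro: less_imp_le)+
  then obtain r l where rl: "greatest_in r K" "least_in l L" by blast
  have cons: "consecutive S K L"
    unfolding consecutive_def
  proof (intro conjI notI)
    show "left_end K < left_end L"
      unfolding left_end_less_iff[OF K L] using aK La by blast
    assume "\<exists>I\<in>S - {{}}. left_end K < left_end I \<and> left_end I < left_end L"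
    then obtain I where I: "I \<in> S - {{}}" "left_end K < left_end I" "left_end I < left_end L"
      by blast
    obtain u where u: "u \<in> I" "\<And>y. y \<in> K \<Longrightarrow> y < u"
      using above_if_left_end_less[OF K I(1,2)] by blast
    obtain v where v: "v \<in> I" "\<And>y. y \<in> L \<Longrightarrow> v < y"
      using I left_end_less_iff[OF I(1) L] by blast
    have uv: "u \<in> X" "v \<in> X" using u v I in_carrier by auto
    \<comment> \<open>The point \<open>u\<close> is above \<open>a\<close> and outside
      \<open>K\<close>, which contains \<open>X \<inter> {a..<b}\<close>. Dually
      \<open>v \<le> a\<close>, so that \<open>I\<close> would cover the whole interval.\<close>
    have "b \<le> u"
    proof (rule ccontr)
      assume "\<not> b \<le> u"
      then have "u \<in> X \<inter> {a..<b}" using uv(1) u(2)[OF aK] by auto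
      then have "u \<in> K" using long by blast
      then show False using u(2) by blast
    qed
    moreover have "v \<le> a"
    proof (rule ccontr)
      assume "\<not> v \<le> a"
      then have "v \<in> X \<inter> {a<..b}" using uv(2) v(2)[OF bL] by auto
      then have "v \<in> L" using long by blast
      then show False using v(2) by blast
    qed
    ultimately have "X \<inter> {a..b} \<subseteq> I"
      using convex[OF _ v(1) u(1)] I(1) by auto
    then show False using long I(1) by blast
  qed (use K L in auto)
  note ps = gap_pred_succ[OF cons rl]
  have "l \<in> L" "r \<in> K" using rl by (auto simp: least_in_def greatest_in_def)
  \<comment> \<open>\<open>L\<close> lies above \<open>a\<close> and contains all of
    \<open>X \<inter> {a<..b}\<close>, so its least element \<open>l\<close> comes immediately after
    \<open>a\<close>. Likewise \<open>b\<close> comes immediately after \<open>r\<close>.\<close>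
  have "pred_on X l = a"
  proof (rule antisym)
    show "a \<le> pred_on X l" using ps La \<open>l \<in> L\<close> long by auto
    show "pred_on X l \<le> a"
    proof (rule ccontr)
      assume *: "\<not> ?thesis"
      have "pred_on X l < b" using ps(2) rl bL by (auto simp: least_in_def intro: less_le_trans)
      then have "pred_on X l \<in> X \<inter> {a<..b}" using * ps(1) by auto
      then have "pred_on X l \<in> L" using long by blast
      then show False using ps(2) rl by (auto simp: least_in_def)
    qed
  qed
  moreover have "succ_on X r = b"
  proof (rule antisym)
    show "succ_on X r \<le> b" using ps Kb \<open>r \<in> K\<close> long by auto
    show "b \<le> succ_on X r"
    proof (rule ccontr)
      assume *: "\<not> ?thesis"
      have "a < succ_on X r"
        using ps(5) rl aK by (auto simp: greatest_in_def intro: le_less_trans)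
      then have "succ_on X r \<in> X \<inter> {a..<b}" using * ps(4) by auto
      then have "succ_on X r \<in> K" using long by blast
      then show False using ps(5) rl by (auto simp: greatest_in_def)
    qed
  qed
  ultimately have "X \<inter> {a..b} \<in> piece X (Gap K L r l)" using long by (simp add: eps_def)
  then show ?thesis using labels.gap[OF cons rl] by blast
qed

lemma minimal_uncovered_subset:
  "minimal_uncovered X S \<subseteq> (\<Union>i\<in>labels S. piece X i)"
proof (cases "S = {}")
  case True
  have "{} \<in> fin_intervals X" by (auto simp: fin_intervals_def intervals_def)
  then have "minimal_uncovered X S \<subseteq> {{}}"
    using True by (auto simp: minimal_uncovered_def)
  also have "\<dots> \<subseteq> (\<Union>i\<in>labels S. piece X i)"
    using labels.empty_family[OF True] by force
  finally show ?thesis .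
next
  case S: False
  show ?thesis
  proof
    fix A assume "A \<in> minimal_uncovered X S"
    then show "A \<in> (\<Union>i\<in>labels S. piece X i)" using S
    proof (cases rule: mem_minimal_uncovered_cases)
      case (single x)
      then show ?thesis using uncovered_point_in_piece[of x] S by auto
    next
      case (long a b K L)
      then show ?thesis using long_interval_in_gap[of a b K L] by auto
    qed
  qed
qed

section \<open>Disjointness of the pieces\<close>

lemma least_unique: "least_in l I \<Longrightarrow> least_in l' I \<Longrightarrow> l = l'"
  by (auto simp: least_in_def intro: antisym)

lemma greatest_unique: "greatest_in r I \<Longrightarrow> greatest_in r' I \<Longrightarrow> r = r'"
  by (auto simp: greatest_in_def intro: antisym)

text \<open>It suffices that \<open>J\<close> and \<open>J'\<close> have equal left ends: then
  \<open>J = J'\<close>, and \<open>I\<close> and \<open>I'\<close> are both the last member before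
  it.\<close>

lemma gap_unique:
  assumes 1: "consecutive S I J" "greatest_in r I" "least_in l J"
    and 2: "consecutive S I' J'" "greatest_in r' I'" "least_in l' J'"
    and A: "A \<in> piece X (Gap I J r l)" "A \<in> piece X (Gap I' J' r' l')"
  shows "Gap I J r l = Gap I' J' r' l'"
proof -
  note c1 = consecutiveD[OF 1(1)] and c2 = consecutiveD[OF 2(1)]
  \<comment> \<open>If \<open>K\<close> began before \<open>K'\<close>, it would begin no later than
    \<open>H'\<close>. But \<open>s' \<in> H'\<close> satisfies \<open>s' < x < k\<close>, so
    \<open>H'\<close> begins before \<open>K\<close>.\<close>
  have below: "\<not> left_end K < left_end K'"
    if c: "consecutive S H K" "greatest_in s H" "least_in k K"
      "consecutive S H' K'" "greatest_in s' H'" "least_in k' K'"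
      and x: "s < x" "x < k" "s' < x" "x < k'" for H K H' K' s k s' k' x
  proof
    note d = consecutiveD[OF c(1)] and d' = consecutiveD[OF c(4)]
    assume "left_end K < left_end K'"
    then have le: "left_end K \<le> left_end H'" by (rule d'(4)[OF d(2)])
    have "left_end H' < left_end K"
      unfolding left_end_less_iff[OF d'(1) d(2)]
      using c(3,5) x by (auto simp: greatest_in_def least_in_def intro!: bexI[of _ s'])
    with le show False by simp
  qed
  have "left_end J = left_end J'"
  proof (cases "\<exists>x. A = {x}")
    case True
    then obtain x where "A = {x}" ..
    then have "r < x" "x < l" "r' < x" "x < l'"
      using A singleton_in_gap[OF 1, of x] singleton_in_gap[OF 2, of x] by auto
    then show ?thesis using below[OF 1 2, of x] below[OF 2 1, of x] by auto
  next
    case False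
    note p1 = gap_pred_succ[OF 1] and p2 = gap_pred_succ[OF 2]
    note n1 = nonsingleton_in_gap[OF A(1) False] and n2 = nonsingleton_in_gap[OF A(2) False]
    \<comment> \<open>Each of the two is the least element of \<open>A\<close>, so they coincide,
      and the predecessor determines \<open>l\<close>.\<close>
    have "pred_on X l \<in> A" "pred_on X l' \<in> A" using n1 n2 p1(1) p2(1) by fastforce+
    then have eq: "pred_on X l = pred_on X l'"
      using n1(1) n2(1) by (metis IntD2 antisym atLeastAtMost_iff)
    have "l \<in> X" "l' \<in> X" using 1 2 c1 c2 in_carrier by (auto simp: least_in_def)
    then have "l = l'"
      using eq p1(2) p2(2) p1(3)[of l'] p2(3)[of l] by (metis leD linorder_neqE)
    then show ?thesis using 1 2 by (simp add: left_end_least)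
  qed
  then have J: "J = J'" using left_end_inj c1 c2 by blast
  have "left_end I = left_end I'"
    using c1(4)[OF c2(1)] c2(4)[OF c1(1)] c1(3) c2(3) J by auto
  then have "I = I'" using left_end_inj c1 c2 by blast
  with J show ?thesis using 1 2 least_unique greatest_unique by blast
qed

text \<open>In both cases \<open>S\<close> has no nonempty member, which rules out the first three
  kinds of label.\<close>

lemma labels_degenerate:
  assumes "i \<in> labels S" "S = {} \<or> {} \<in> S"
  shows "i = (if S = {} then Empty_Family else Empty_Member)"
proof -
  have "S - {{}} = {}" using assms(2) antichain by (auto simp: incl_antichain_def)
  with assms(1) show ?thesis
    by cases (auto simp: consecutive_def first_interval_def last_interval_def)
qed

lemma in_Before_iff: "A \<in> piece X (Before l) \<longleftrightarrow> (\<exists>x\<in>X. x < l \<and> A = {x})"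
  by (auto simp: tilde_def not_le)

lemma in_After_iff: "A \<in> piece X (After r) \<longleftrightarrow> (\<exists>x\<in>X. r < x \<and> A = {x})"
  by (auto simp: tilde_def not_le)

text \<open>Labels of different kinds are separated by position: \<open>Before\<close> pieces lie
  below all members, \<open>After\<close> pieces above all members, and singletons of a gap between
  two members.\<close>

lemma piece_unique:
  assumes ij: "i \<in> labels S" "j \<in> labels S" and A: "A \<in> piece X i" "A \<in> piece X j"
  shows "i = j"
proof (cases "S = {} \<or> {} \<in> S")
  case True
  then show ?thesis using ij labels_degenerate by metis
next
  case False
  have gap_before: False
    if c: "consecutive S I J" "greatest_in r I" "least_in l J"
      and f: "first_interval S K" "least_in k K"
      and A: "A \<in> piece X (Gap I J r l)" "A \<in> piece X (Before k)" for I J r l K k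
  proof -
    \<comment> \<open>A \<open>Before\<close> piece has only singletons, so the long interval of a
      gap cannot occur here.\<close>
    obtain x where "A = {x}" "x < k" using A(2) in_Before_iff by auto
    moreover have "r < x" using A(1) calculation singleton_in_gap[OF c, of x] by auto
    moreover have "k \<le> r"
      using first_least_le[OF f, of I r] c consecutiveD[OF c(1)] by (auto simp: greatest_in_def)
    ultimately show False by auto
  qed
  have gap_after: False
    if c: "consecutive S I J" "greatest_in r I" "least_in l J"
      and f: "last_interval S K" "greatest_in k K"
      and A: "A \<in> piece X (Gap I J r l)" "A \<in> piece X (After k)" for I J r l K k
  proof -
    obtain x where "A = {x}" "k < x" using A(2) in_After_iff by auto
    moreover have "x < l" using A(1) calculation singleton_in_gap[OF c, of x] by auto
    moreover have "l \<le> k"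
      using last_greatest_ge[OF f, of J l] c consecutiveD[OF c(1)] by (auto simp: least_in_def)
    ultimately show False by auto
  qed
  have before_after: False
    if f: "first_interval S I" "least_in l I" and g: "last_interval S K" "greatest_in k K"
      and A: "A \<in> piece X (Before l)" "A \<in> piece X (After k)" for I l K k
  proof -
    have "l \<le> k"
      using first_least_le[OF f, of K k] g by (auto simp: last_interval_def greatest_in_def)
    then show False using A unfolding in_Before_iff in_After_iff by force
  qed
  have before_before: "l = l'"
    if "first_interval S I" "least_in l I" "first_interval S I'" "least_in l' I'" for I l I' l'
    using that first_least_le[of I l I' l'] first_least_le[of I' l' I l]
    by (auto simp: first_interval_def least_in_def)
  have after_after: "l = l'"
    if "last_interval S I" "greatest_in l I" "last_interval S I'" "greatest_in l' I'" for I l I' l'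
    using that last_greatest_ge[of I l I' l'] last_greatest_ge[of I' l' I l]
    by (auto simp: last_interval_def greatest_in_def)
  from ij(1) show ?thesis
  proof cases
    case (gap I J r l)
    note i = this
    from ij(2) show ?thesis
      by cases (use i A False gap_unique[OF gap(2-4)] gap_before[OF gap(2-4)]
        gap_after[OF gap(2-4)] in \<open>blast+\<close>)
  next
    case (before I l)
    note i = this
    from ij(2) show ?thesis
      by cases (use i A False gap_before[OF _ _ _ before(2-3)] before_before[OF before(2-3)]
        before_after[OF before(2-3)] in \<open>blast+\<close>)
  next
    case (after I r)
    note i = this
    from ij(2) show ?thesis
      by cases (use i A False gap_after[OF _ _ _ after(2-3)] after_after[OF after(2-3)]
        before_after[OF _ _ after(2-3)] in \<open>blast+\<close>)
  qed (use False in auto)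
qed

end

theorem theorem20:
  fixes X :: "'a::linorder set" and S :: "'a set set" and M :: "'a set set"
  assumes "locally_finite_on X"
    and "S \<subseteq> intervals X" and "incl_antichain S"
    and "M = \<Sqinter>\<^bsub>EE X\<^esub> (tilde X ` S)"
  shows "M = (\<Union>i\<in>labels S. piece X i) \<and> disjoint_family_on (piece X) (labels S)"
proof -
  interpret interval_antichain X S using assms by unfold_locales
  have "M = (\<Union>i\<in>labels S. piece X i)"
    using assms(4) minimal_uncovered_subset piece_subset by (auto simp: Inf_tilde)
  moreover have "disjoint_family_on (piece X) (labels S)"
    unfolding disjoint_family_on_def using piece_unique by blast
  ultimately show ?thesis by blast
qed

end
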